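(* Let $H$ be an infinite finitely generated amenable group and let $F_2$ be the free group on two generators. There is no action of $F_2$ by permutations on the set $H$ that is transitive, almost free, and such that every $H$-invariant mean on $H$ is $F_2$-invariant.
   Context: A mean on $H$ is a finitely additive $\mu:2^H\to[0,1]$ with $\mu(H)=1$; it is $H$-invariant if $\mu(hA)=\mu(A)$ for all $h\in H$, $A\subseteq H$ (invariance under left multiplication), and $F_2$-invariant if $\mu(gA)=\mu(A)$ for all $g\in F_2$. An action is almost free if every nontrivial element fixes only finitely many points. *)

theory Defs
  imports "HOL-Algebra.Algebra"
begin

definition is_mean :: "('a, 'b) monoid_scheme \<Rightarrow> ('a set \<Rightarrow> real) \<Rightarrow> bool" where
  "is_mean G \<mu> \<longleftrightarrow>
     (\<forall>A. A \<subseteq> carrier G \<longrightarrow> 0 \<le> \<mu> A \<and> \<mu> A \<le> 1) \<and>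
     \<mu> (carrier G) = 1 \<and>
     (\<forall>A B. A \<subseteq> carrier G \<longrightarrow> B \<subseteq> carrier G \<longrightarrow> A \<inter> B = {} \<longrightarrow>
            \<mu> (A \<union> B) = \<mu> A + \<mu> B)"

definition left_invariant_mean :: "('a, 'b) monoid_scheme \<Rightarrow> ('a set \<Rightarrow> real) \<Rightarrow> bool" where
  "left_invariant_mean G \<mu> \<longleftrightarrow> is_mean G \<mu> \<and>
     (\<forall>h A. h \<in> carrier G \<longrightarrow> A \<subseteq> carrier G \<longrightarrow> \<mu> (h <#\<^bsub>G\<^esub> A) = \<mu> A)"

definition amenable :: "('a, 'b) monoid_scheme \<Rightarrow> bool" where
  "amenable G \<longleftrightarrow> (\<exists>\<mu>. left_invariant_mean G \<mu>)"

definition finitely_generated :: "('a, 'b) monoid_scheme \<Rightarrow> bool" where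
  "finitely_generated G \<longleftrightarrow>
     (\<exists>S. finite S \<and> S \<subseteq> carrier G \<and> generate G S = carrier G)"

text \<open>Elements of F_2 = <a,b> are represented by reduced words. A letter is a pair
  (g, e): g = False means generator a, g = True means generator b;
  e = False means the generator itself, e = True means its inverse.\<close>
type_synonym f2_letter = "bool \<times> bool"

definition reduced_word :: "f2_letter list \<Rightarrow> bool" where
  "reduced_word w \<longleftrightarrow>
     (\<forall>i. Suc i < length w \<longrightarrow>
          \<not> (fst (w ! i) = fst (w ! Suc i) \<and> snd (w ! i) \<noteq> snd (w ! Suc i)))"

text \<open>An action of F_2 by permutations on a set U is determined (universal
  property of free groups) by the permutations sa, sb of U assigned to the generators.
  The action of a letter and of a word (leftmost letter acts last):\<close>
definition letter_act :: "'a set \<Rightarrow> ('a \<Rightarrow> 'a) \<Rightarrow> ('a \<Rightarrow> 'a) \<Rightarrow> f2_letter \<Rightarrow> 'a \<Rightarrow> 'a" where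
  "letter_act U sa sb c =
     (if snd c then Hilbert_Choice.inv_into U (if fst c then sb else sa) else (if fst c then sb else sa))"

fun word_act :: "'a set \<Rightarrow> ('a \<Rightarrow> 'a) \<Rightarrow> ('a \<Rightarrow> 'a) \<Rightarrow> f2_letter list \<Rightarrow> 'a \<Rightarrow> 'a" where
  "word_act U sa sb [] x = x"
| "word_act U sa sb (c # w) x = letter_act U sa sb c (word_act U sa sb w x)"

definition f2_action_transitive :: "'a set \<Rightarrow> ('a \<Rightarrow> 'a) \<Rightarrow> ('a \<Rightarrow> 'a) \<Rightarrow> bool" where
  "f2_action_transitive U sa sb \<longleftrightarrow>
     (\<forall>x\<in>U. \<forall>y\<in>U. \<exists>w. reduced_word w \<and> word_act U sa sb w x = y)"

definition f2_action_almost_free :: "'a set \<Rightarrow> ('a \<Rightarrow> 'a) \<Rightarrow> ('a \<Rightarrow> 'a) \<Rightarrow> bool" where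
  "f2_action_almost_free U sa sb \<longleftrightarrow>
     (\<forall>w. reduced_word w \<and> w \<noteq> [] \<longrightarrow> finite {x\<in>U. word_act U sa sb w x = x})"

definition f2_invariant :: "'a set \<Rightarrow> ('a \<Rightarrow> 'a) \<Rightarrow> ('a \<Rightarrow> 'a) \<Rightarrow> ('a set \<Rightarrow> real) \<Rightarrow> bool" where
  "f2_invariant U sa sb \<mu> \<longleftrightarrow>
     (\<forall>w A. reduced_word w \<longrightarrow> A \<subseteq> U \<longrightarrow> \<mu> (word_act U sa sb w ` A) = \<mu> A)"

end

theory Submission
  imports Defs "HOL-Analysis.Function_Topology"
begin

text \<open>Right translates of a left Folner set are again left Folner sets, so they can be moved off any
  finite set. Choose a sequence of them, \<open>F n\<close>, so that no word of length at most
  \<open>card (F n)\<close> has a fixed point in \<open>F n\<close> and no generator maps a point of \<open>F m\<close> into \<open>F n\<close> for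
  \<open>m \<noteq> n\<close>. A limit \<open>\<mu>\<close> of the uniform means on the \<open>F n\<close> is left invariant and gives the union
  \<open>A\<close> of the \<open>F n\<close> mean 1. If \<open>\<mu>\<close> were invariant under \<open>F\<^sub>2\<close>, both generators would map almost all of
  \<open>F n\<close> into \<open>F n\<close>, for some \<open>n\<close>. But the graph which the generators induce on \<open>F n\<close> is a forest, so it
  has fewer than \<open>card (F n)\<close> edges.

  Folner sets come from Hall's theorem: without them some finite \<open>K\<close> at least doubles every finite
  set, and a matching gives two disjoint piecewise translated copies of the group inside itself,
  of total mean 2.\<close>

section \<open>Hall's marriage theorem for families of finite sets\<close>

definition hall :: "'i set \<Rightarrow> ('i \<Rightarrow> 'b set) \<Rightarrow> bool" where
  "hall I A \<longleftrightarrow> (\<forall>J\<subseteq>I. finite J \<longrightarrow> card J \<le> card (\<Union>i\<in>J. A i))"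

text \<open>Rado's argument: if removing either of two elements of \<open>A i\<close> violates Hall's condition, the
  two deficient sets contradict the submodularity of the cardinality of the union.\<close>

lemma hall_singleton:
  assumes fin: "\<And>i. i \<in> I \<Longrightarrow> finite (A i)" and "hall I A"
    and minimal: "\<And>i x. i \<in> I \<Longrightarrow> x \<in> A i \<Longrightarrow> \<not> hall I (A(i := A i - {x}))"
    and "i \<in> I" "x \<in> A i" "y \<in> A i"
  shows "x = y"
proof (rule ccontr)
  assume "x \<noteq> y"
  have deficient: "\<exists>J\<subseteq>I - {i}. finite J \<and> card ((\<Union>j\<in>J. A j) \<union> (A i - {z})) \<le> card J"
    if z: "z \<in> A i" for z
  proof -
    from minimal[OF \<open>i \<in> I\<close> z] obtain J where J: "J \<subseteq> I" "finite J"
      "card (\<Union>j\<in>J. (A(i := A i - {z})) j) < card J"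
      unfolding hall_def by (auto simp: not_le)
    have "i \<in> J"
    proof (rule ccontr)
      assume "i \<notin> J"
      then have "(\<Union>j\<in>J. (A(i := A i - {z})) j) = (\<Union>j\<in>J. A j)" by auto
      with J \<open>hall I A\<close> show False unfolding hall_def by (metis not_le)
    qed
    then have "(\<Union>j\<in>J. (A(i := A i - {z})) j) = (\<Union>j\<in>J - {i}. A j) \<union> (A i - {z})"
      by (auto split: if_splits)
    with J \<open>i \<in> J\<close> show ?thesis
      by (intro exI[of _ "J - {i}"]) auto
  qed
  from deficient[OF \<open>x \<in> A i\<close>] obtain J where J: "J \<subseteq> I - {i}" "finite J"
    "card ((\<Union>j\<in>J. A j) \<union> (A i - {x})) \<le> card J" by auto
  from deficient[OF \<open>y \<in> A i\<close>] obtain K where K: "K \<subseteq> I - {i}" "finite K"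
    "card ((\<Union>j\<in>K. A j) \<union> (A i - {y})) \<le> card K" by auto
  define P where "P = (\<Union>j\<in>J. A j) \<union> (A i - {x})"
  define Q where "Q = (\<Union>j\<in>K. A j) \<union> (A i - {y})"
  have fPQ: "finite P" "finite Q"
    using J K fin \<open>i \<in> I\<close> unfolding P_def Q_def by auto
  \<comment> \<open>As \<open>x\<close> and \<open>y\<close> differ, this union recovers all of
    \<open>A i\<close> and so serves one index beyond \<open>J \<union> K\<close>. Hence |J| + |K|
    \<ge> |P| + |Q| = |P \<union> Q| + |P \<inter> Q| \<ge> |J| + |K| + 1.\<close>
  have "P \<union> Q = (\<Union>j\<in>insert i (J \<union> K). A j)"
    using \<open>x \<noteq> y\<close> unfolding P_def Q_def by auto
  then have "card (insert i (J \<union> K)) \<le> card (P \<union> Q)"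
    using \<open>hall I A\<close> J K \<open>i \<in> I\<close> unfolding hall_def
    by (metis Diff_subset finite.insertI finite_UnI insert_subset order_trans Un_least)
  moreover have "card (insert i (J \<union> K)) = Suc (card (J \<union> K))"
    using J K by (subst card_insert_disjoint) auto
  moreover have "card (J \<inter> K) \<le> card (\<Union>j\<in>J \<inter> K. A j)"
    using \<open>hall I A\<close> J K unfolding hall_def
    by (metis Diff_subset finite_Int inf.coboundedI1 order_trans)
  moreover have "card (\<Union>j\<in>J \<inter> K. A j) \<le> card (P \<inter> Q)"
    using fPQ unfolding P_def Q_def by (intro card_mono) auto
  moreover have "card P + card Q = card (P \<union> Q) + card (P \<inter> Q)"
    using fPQ by (rule card_Un_Int)
  moreover have "card J + card K = card (J \<union> K) + card (J \<inter> K)"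
    using J K by (intro card_Un_Int)
  ultimately show False
    using J(3) K(3) unfolding P_def[symmetric] Q_def[symmetric] by linarith
qed

text \<open>Shrinking the family as far as Hall's condition permits leaves singletons. Hall's
  condition for a single index makes each of them nonempty, and for two indices it makes them
  distinct.\<close>

theorem hall_marriage:
  assumes fin: "\<And>i. i \<in> I \<Longrightarrow> finite (A i)" and "hall I A"
  obtains f where "inj_on f I" "\<And>i. i \<in> I \<Longrightarrow> f i \<in> A i"
proof -
  \<comment> \<open>Zorn's lemma yields a maximal set of pairs to delete, i.e. a minimal family.\<close>
  define R where "R D i = A i - D `` {i}" for D i
  have "\<exists>M\<in>{D. hall I (R D)}. \<forall>P\<in>{D. hall I (R D)}. M \<subseteq> P \<longrightarrow> P = M"
  proof (rule subset_Zorn_nonempty)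
    have "R {} = A" by (auto simp: R_def)
    with \<open>hall I A\<close> show "{D. hall I (R D)} \<noteq> {}" by auto
  next
    fix \<C> assume ne: "\<C> \<noteq> {}" and chain: "subset.chain {D. hall I (R D)} \<C>"
    have "card J \<le> card (\<Union>i\<in>J. R (\<Union>\<C>) i)" if J: "J \<subseteq> I" "finite J" for J
    proof -
      \<comment> \<open>Only the finitely many pairs over \<open>J\<close> matter, so one member of
        the chain already deletes everything that \<open>\<Union>\<C>\<close> deletes among
        them.\<close>
      have "finite (Sigma J A \<inter> \<Union>\<C>)" using J fin by (intro finite_Int disjI1 finite_SigmaI) auto
      then obtain D where D: "D \<in> \<C>" "Sigma J A \<inter> \<Union>\<C> \<subseteq> D"
        using finite_subset_Union_chain[OF _ _ ne chain] by (metis inf_le2)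
      have "(\<Union>i\<in>J. R (\<Union>\<C>) i) = (\<Union>i\<in>J. R D i)"
        using D by (auto simp: R_def)
      moreover have "hall I (R D)" using chain D(1) by (auto simp: subset_chain_def)
      ultimately show ?thesis using J by (auto simp: hall_def)
    qed
    then show "\<Union>\<C> \<in> {D. hall I (R D)}" by (auto simp: hall_def)
  qed
  then obtain D where D: "hall I (R D)" and max: "\<And>P. hall I (R P) \<Longrightarrow> D \<subseteq> P \<Longrightarrow> P = D"
    by auto
  have finR: "\<And>i. i \<in> I \<Longrightarrow> finite (R D i)" using fin by (auto simp: R_def)
  have "\<not> hall I ((R D)(i := R D i - {x}))" if "i \<in> I" "x \<in> R D i" for i x
  proof
    have "R (insert (i,x) D) = (R D)(i := R D i - {x})" by (rule ext) (auto simp: R_def)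
    moreover assume "hall I ((R D)(i := R D i - {x}))"
    ultimately have "insert (i,x) D = D" using max by (metis subset_insertI)
    with that show False by (auto simp: R_def)
  qed
  note single = hall_singleton[OF finR D this]
  have card_le: "card J \<le> card (\<Union>i\<in>J. R D i)" if "J \<subseteq> I" "finite J" for J
    using D that unfolding hall_def by blast
  have "\<exists>x. x \<in> R D i" if "i \<in> I" for i
    using card_le[of "{i}"] that by (cases "R D i = {}") auto
  then obtain f where f: "\<And>i. i \<in> I \<Longrightarrow> f i \<in> R D i" by metis
  have eq: "R D i = {f i}" if "i \<in> I" for i
    using f single that by blast
  show ?thesis
  proof
    show "inj_on f I"
    proof (rule inj_onI, rule ccontr)
      fix i j assume ij: "i \<in> I" "j \<in> I" "f i = f j" "i \<noteq> j"
      then have "(\<Union>k\<in>{i, j}. R D k) = {f i}" using eq by auto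
      with card_le[of "{i, j}"] ij show False by auto
    qed
    show "\<And>i. i \<in> I \<Longrightarrow> f i \<in> A i" using f by (auto simp: R_def)
  qed
qed

section \<open>Finite sets without short cycles\<close>

lemma letter_act_bij:
  assumes "bij_betw sa U U" "bij_betw sb U U"
  shows "bij_betw (letter_act U sa sb c) U U"
  using assms by (auto simp: letter_act_def bij_betw_inv_into)

lemma letter_act_inverse:
  assumes "bij_betw sa U U" "bij_betw sb U U" "x \<in> U"
  shows "letter_act U sa sb (g, True) (letter_act U sa sb (g, False) x) = x"
  using assms by (auto simp: letter_act_def bij_betw_inv_into_left)

text \<open>Restricting to positive letters lists each edge of the induced graph once, by source and
  label.\<close>

definition f2_edges :: "'a set \<Rightarrow> ('a \<Rightarrow> 'a) \<Rightarrow> ('a \<Rightarrow> 'a) \<Rightarrow> 'a set \<Rightarrow> ('a \<times> bool) set" where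
  "f2_edges U sa sb F = {(x, g). x \<in> F \<and> letter_act U sa sb (g, False) x \<in> F}"

text \<open>The half-edges at \<open>x\<close>: inverse letters account for incoming edges. For
  \<open>x\<close> in \<open>F\<close> the cardinality is the degree, a loop counting twice.\<close>

definition f2_star :: "'a set \<Rightarrow> ('a \<Rightarrow> 'a) \<Rightarrow> ('a \<Rightarrow> 'a) \<Rightarrow> 'a set \<Rightarrow> 'a \<Rightarrow> f2_letter set" where
  "f2_star U sa sb F x = {c. letter_act U sa sb c x \<in> F}"

lemma finite_f2_edges: "finite F \<Longrightarrow> finite (f2_edges U sa sb F)"
  by (rule finite_subset[of _ "F \<times> UNIV"]) (auto simp: f2_edges_def)

text \<open>Each lost edge is incident with \<open>x\<close> and is charged to the letter by which
  it leaves \<open>x\<close>: the generator if \<open>x\<close> is its source, the inverse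
  otherwise. Bijectivity makes the charge injective. A loop is charged only once, hence an
  inequality.\<close>

lemma card_f2_edges_remove:
  assumes bij: "bij_betw sa U U" "bij_betw sb U U" and F: "finite F" "F \<subseteq> U"
  shows "card (f2_edges U sa sb F) \<le> card (f2_edges U sa sb (F - {x})) + card (f2_star U sa sb F x)"
proof -
  let ?E = "f2_edges U sa sb F" and ?E' = "f2_edges U sa sb (F - {x})"
  define \<phi> :: "'a \<times> bool \<Rightarrow> f2_letter"
    where "\<phi> = (\<lambda>(y, g). if y = x then (g, False) else (g, True))"
  have inj: "inj_on (letter_act U sa sb c) U" for c
    using letter_act_bij[OF bij] by (rule bij_betw_imp_inj_on)
  have ends: "letter_act U sa sb (g, False) y = x"
    if "(y, g) \<in> ?E - ?E'" "y \<noteq> x" for y g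
    using that by (auto simp: f2_edges_def)
  have "inj_on \<phi> (?E - ?E')"
  proof (rule inj_onI, clarify)
    fix y g y' g'
    assume *: "(y, g) \<in> ?E" "(y', g') \<in> ?E" "(y, g) \<notin> ?E'" "(y', g') \<notin> ?E'" "\<phi> (y, g) = \<phi> (y', g')"
    from *(5) have "g = g'" "y = x \<longleftrightarrow> y' = x" by (auto simp: \<phi>_def split: if_splits)
    moreover have "y = y'" if "y \<noteq> x" "y' \<noteq> x"
      using ends[of y g] ends[of y' g'] * that F \<open>g = g'\<close> inj[of "(g, False)"]
      by (auto simp: f2_edges_def inj_on_def subset_iff)
    ultimately show "y = y' \<and> g = g'" by blast
  qed
  moreover have "\<phi> (y, g) \<in> f2_star U sa sb F x" if *: "(y, g) \<in> ?E - ?E'" for y g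
  proof (cases "y = x")
    case True
    then show ?thesis using * by (auto simp: \<phi>_def f2_star_def f2_edges_def)
  next
    case False
    have y: "y \<in> F" "y \<in> U" using * F by (auto simp: f2_edges_def)
    have "letter_act U sa sb (g, True) x = y"
      using ends[OF * False] letter_act_inverse[OF bij y(2), of g] by simp
    then show ?thesis using False y by (simp add: \<phi>_def f2_star_def)
  qed
  then have "\<phi> ` (?E - ?E') \<subseteq> f2_star U sa sb F x" by (intro image_subsetI) (metis surj_pair)
  ultimately have "card (?E - ?E') \<le> card (f2_star U sa sb F x)"
    by (metis card_inj_on_le finite)
  moreover have "card ?E \<le> card (?E' \<union> (?E - ?E'))"
    using F by (intro card_mono) (auto intro: finite_f2_edges)
  ultimately show ?thesis
    using card_Un_le[of ?E' "?E - ?E'"] by linarith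
qed

text \<open>If every vertex had two edges, a non-backtracking walk would never leave the finite set
  and so would close up, which exhibits a point fixed by a short reduced word.\<close>

lemma f2_leaf_exists:
  assumes F: "finite F" "F \<noteq> {}"
    and free: "\<And>w x. reduced_word w \<Longrightarrow> w \<noteq> [] \<Longrightarrow> length w \<le> card F \<Longrightarrow> x \<in> F \<Longrightarrow>
                 word_act U sa sb w x \<noteq> x"
  obtains x where "x \<in> F" "card (f2_star U sa sb F x) \<le> 1"
proof (rule ccontr)
  assume "\<not> thesis"
  with that have two: "\<And>x. x \<in> F \<Longrightarrow> \<not> card (f2_star U sa sb F x) \<le> 1" by blast
  have another: "\<exists>c'. c' \<noteq> c \<and> letter_act U sa sb c' x \<in> F" if "x \<in> F" for x c
  proof (rule ccontr)
    assume "\<not> ?thesis"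
    then have "f2_star U sa sb F x \<subseteq> {c}" by (auto simp: f2_star_def)
    then have "card (f2_star U sa sb F x) \<le> card {c}" by (intro card_mono) auto
    with two[OF that] show False by simp
  qed
  \<comment> \<open>The state records the current point and the letter that led to it; the next
    letter must not undo it. The letter at time 0 is arbitrary and enters none of the words
    \<open>w i k\<close> below.\<close>
  have "\<exists>s. \<forall>n. fst (s n) \<in> F \<and>
          (fst (s (Suc n)) = letter_act U sa sb (snd (s (Suc n))) (fst (s n)) \<and>
           snd (s (Suc n)) \<noteq> (fst (snd (s n)), \<not> snd (snd (s n))))"
  proof (rule dependent_nat_choice)
    show "\<exists>s. fst s \<in> F" using F by auto
  next
    fix s :: "'a \<times> f2_letter" and n :: nat
    assume "fst s \<in> F"
    from another[OF this] obtain c where "c \<noteq> (fst (snd s), \<not> snd (snd s))"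
      "letter_act U sa sb c (fst s) \<in> F" by blast
    then show "\<exists>t. fst t \<in> F \<and> (fst t = letter_act U sa sb (snd t) (fst s) \<and>
           snd t \<noteq> (fst (snd s), \<not> snd (snd s)))"
      by (intro exI[of _ "(letter_act U sa sb c (fst s), c)"]) auto
  qed
  then obtain s where s: "\<And>n. fst (s n) \<in> F"
    "\<And>n. fst (s (Suc n)) = letter_act U sa sb (snd (s (Suc n))) (fst (s n))"
    "\<And>n. snd (s (Suc n)) \<noteq> (fst (snd (s n)), \<not> snd (snd (s n)))"
    by blast
  define p where "p n = fst (s n)" for n
  define c where "c n = snd (s n)" for n
  \<comment> \<open>The list is reversed because the leftmost letter acts last.\<close>
  define w where "w i k = map c (rev [Suc i..<Suc (i + k)])" for i k
  have act: "word_act U sa sb (w i k) (p i) = p (i + k)" for i k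
  proof (induction k)
    case (Suc k)
    have "w i (Suc k) = c (Suc (i + k)) # w i k" by (simp add: w_def)
    with Suc show ?case by (simp add: p_def c_def s(2))
  qed (simp add: w_def)
  have red: "reduced_word (w i k)" for i k
    unfolding reduced_word_def
  proof (intro allI impI)
    fix j assume j: "Suc j < length (w i k)"
    then have *: "w i k ! Suc j = c (i + k - Suc j)" "w i k ! j = c (Suc (i + k - Suc j))"
      by (auto simp: w_def rev_nth simp del: upt_Suc intro!: arg_cong[of _ _ c])
    show "\<not> (fst (w i k ! j) = fst (w i k ! Suc j) \<and> snd (w i k ! j) \<noteq> snd (w i k ! Suc j))"
      unfolding * using s(3)[of "i + k - Suc j"] by (auto simp: c_def prod_eq_iff)
  qed
  \<comment> \<open>Among \<open>card F + 1\<close> successive positions one repeats, so the closed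
    walk has length at most \<open>card F\<close>, the range in which \<open>free\<close> excludes
    fixed points.\<close>
  have "p ` {0..card F} \<subseteq> F" using s(1) by (auto simp: p_def)
  then have "card (p ` {0..card F}) < card {0..card F}"
    using card_mono[OF F(1)] by (simp add: le_imp_less_Suc)
  then have "\<not> inj_on p {0..card F}" by (rule pigeonhole)
  then obtain i j where ij: "i < j" "j \<le> card F" "p i = p j"
    unfolding inj_on_def by (metis atLeastAtMost_iff linorder_neqE_nat)
  have "word_act U sa sb (w i (j - i)) (p i) = p i" using ij act[of i "j - i"] by simp
  moreover have "w i (j - i) \<noteq> []" "length (w i (j - i)) \<le> card F" using ij by (auto simp: w_def)
  ultimately show False using free red s(1) by (metis p_def)
qed

text \<open>Pruning a vertex of degree at most one costs at most one edge, and the smaller set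
  inherits \<open>free\<close> because its length bound is smaller. At a single point an edge would
  be a loop, that is, a fixed point of a one-letter word, so the count starts strictly below the
  number of vertices.\<close>

lemma card_f2_edges_less:
  assumes bij: "bij_betw sa U U" "bij_betw sb U U" and F: "finite F" "F \<subseteq> U" "F \<noteq> {}"
    and free: "\<And>w x. reduced_word w \<Longrightarrow> w \<noteq> [] \<Longrightarrow> length w \<le> card F \<Longrightarrow> x \<in> F \<Longrightarrow>
                 word_act U sa sb w x \<noteq> x"
  shows "card (f2_edges U sa sb F) < card F"
  using F free
proof (induction "card F" arbitrary: F rule: less_induct)
  case less
  obtain x where x: "x \<in> F" "card (f2_star U sa sb F x) \<le> 1"
    using f2_leaf_exists[OF less.prems(1,3)] less.prems(4) by metis
  have cardF: "card F = Suc (card (F - {x}))"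
    using x less.prems by (metis card_Suc_Diff1)
  have remove: "card (f2_edges U sa sb F) \<le> card (f2_edges U sa sb (F - {x})) + 1"
    using card_f2_edges_remove[OF bij less.prems(1,2), of x] x(2) by linarith
  show ?case
  proof (cases "F - {x} = {}")
    case True
    then have "F = {x}" using x by auto
    moreover have "letter_act U sa sb (g, False) x \<noteq> x" for g
    proof -
      have "length [(g, False)] \<le> card F" using cardF by simp
      then show ?thesis
        using less.prems(4)[of "[(g, False)]" x] x(1) by (simp add: reduced_word_def)
    qed
    ultimately have "f2_edges U sa sb F = {}" by (auto simp: f2_edges_def)
    with cardF show ?thesis by simp
  next
    case False
    have "card (f2_edges U sa sb (F - {x})) < card (F - {x})"
    proof (rule less.hyps)
      show "card (F - {x}) < card F" using cardF by linarith
    next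
      fix w y assume w: "reduced_word w" "w \<noteq> []" "length w \<le> card (F - {x})" "y \<in> F - {x}"
      then have "length w \<le> card F" using cardF by linarith
      with w show "word_act U sa sb w y \<noteq> y" using less.prems(4)[of w y] by blast
    qed (use less.prems False in auto)
    with remove cardF show ?thesis by linarith
  qed
qed

text \<open>Points of \<open>F\<close> reached from \<open>F\<close> by a generator are ends of
  edges with that label, so the forest bound controls both overlaps together.\<close>

lemma card_image_Int_less:
  assumes bij: "bij_betw sa U U" "bij_betw sb U U" and F: "finite F" "F \<subseteq> U" "F \<noteq> {}"
    and free: "\<And>w x. reduced_word w \<Longrightarrow> w \<noteq> [] \<Longrightarrow> length w \<le> card F \<Longrightarrow> x \<in> F \<Longrightarrow>
                 word_act U sa sb w x \<noteq> x"
  shows "card (sa ` F \<inter> F) + card (sb ` F \<inter> F) < card F"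
proof -
  let ?A = "{x \<in> F. sa x \<in> F}" and ?B = "{x \<in> F. sb x \<in> F}"
  have "f2_edges U sa sb F = ?A \<times> {False} \<union> ?B \<times> {True}"
    by (auto simp: f2_edges_def letter_act_def split: if_splits)
  then have "card (f2_edges U sa sb F) = card ?A + card ?B"
    using F(1) by (subst \<open>_ = _\<close>, subst card_Un_disjoint) (auto simp: card_cartesian_product)
  moreover have "sa ` F \<inter> F = sa ` ?A" "sb ` F \<inter> F = sb ` ?B" by auto
  moreover have "card (sa ` ?A) \<le> card ?A" "card (sb ` ?B) \<le> card ?B"
    using F(1) by (auto intro: card_image_le)
  ultimately show ?thesis using card_f2_edges_less[OF assms] by simp
qed

section \<open>Limits along subfilters\<close>

text \<open>By Tychonoff the cube is compact, so the sequence \<open>f\<close> has a cluster point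
  \<open>l\<close>. A filter takes the place of a subsequence because the index type may be
  uncountable; later it consists of all sets of group elements.\<close>

lemma bounded_family_limit_filter:
  fixes f :: "nat \<Rightarrow> 'i \<Rightarrow> real"
  assumes "\<And>n i. f n i \<in> {0..1}"
  obtains G l where "G \<le> sequentially" "G \<noteq> bot" "\<And>i. ((\<lambda>n. f n i) \<longlongrightarrow> l i) G"
proof -
  let ?K = "PiE UNIV (\<lambda>_. {0..1}) :: ('i \<Rightarrow> real) set"
  have "compactin (product_topology (\<lambda>_. euclidean) UNIV) ?K"
    by (simp add: compactin_PiE)
  then have "compact ?K" by (simp add: euclidean_product_topology)
  moreover have "filtermap f sequentially \<noteq> bot" by (simp add: filtermap_bot_iff)
  moreover have "eventually (\<lambda>x. x \<in> ?K) (filtermap f sequentially)"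
    using assms by (simp add: eventually_filtermap PiE_def Pi_def)
  ultimately obtain l where l: "inf (nhds l) (filtermap f sequentially) \<noteq> bot"
    unfolding compact_filter by blast
  \<comment> \<open>\<open>G\<close> is generated by tails and by preimages under \<open>f\<close>
    of neighbourhoods of \<open>l\<close>; it is proper because \<open>l\<close> is a cluster
    point.\<close>
  define G where "G = inf (filtercomap f (nhds l)) sequentially"
  have "G \<noteq> bot"
  proof
    assume "G = bot"
    then obtain P Q where PQ: "eventually P (nhds l)" "eventually Q sequentially"
      "\<And>n. P (f n) \<Longrightarrow> Q n \<Longrightarrow> False"
      unfolding G_def trivial_limit_def eventually_inf eventually_filtercomap by metis
    have "eventually (\<lambda>x. \<not> P x) (filtermap f sequentially)"
      using PQ(2) unfolding eventually_filtermap by eventually_elim (use PQ(3) in blast)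
    with PQ(1) have "inf (nhds l) (filtermap f sequentially) = bot"
      unfolding trivial_limit_def eventually_inf by blast
    with l show False by simp
  qed
  moreover have "((\<lambda>n. f n i) \<longlongrightarrow> l i) G" for i
  proof -
    have "((\<lambda>x. x i) \<longlongrightarrow> l i) (nhds l)"
    proof (rule topological_tendstoI)
      fix S :: "real set" assume "open S" "l i \<in> S"
      moreover have "open ((\<lambda>x::'i \<Rightarrow> real. x i) -` S)"
        using \<open>open S\<close> by (rule open_vimage) simp
      ultimately show "\<forall>\<^sub>F x in nhds l. x i \<in> S"
        unfolding eventually_nhds by (metis vimageD vimageI)
    qed
    moreover have "filterlim f (nhds l) G"
      unfolding G_def by (rule filterlim_mono[OF filterlim_filtercomap order_refl inf_le1])
    ultimately show ?thesis by (rule filterlim_compose)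
  qed
  moreover have "G \<le> sequentially" by (simp add: G_def)
  ultimately show ?thesis using that by blast
qed

section \<open>Folner sets\<close>

lemma mean_Un_disjoint:
  assumes "is_mean G \<mu>" "A \<subseteq> carrier G" "B \<subseteq> carrier G" "A \<inter> B = {}"
  shows "\<mu> (A \<union> B) = \<mu> A + \<mu> B"
  using assms(1)[unfolded is_mean_def, THEN conjunct2, THEN conjunct2, rule_format, OF assms(2-)] .

lemma mean_le_1:
  assumes "is_mean G \<mu>" "A \<subseteq> carrier G"
  shows "\<mu> A \<le> 1"
  using assms(1)[unfolded is_mean_def, THEN conjunct1, rule_format, OF assms(2)] by simp

lemma mean_finite_Union:
  assumes mean: "is_mean G \<mu>" and "finite K" and "\<And>k. k \<in> K \<Longrightarrow> B k \<subseteq> carrier G"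
    and "\<And>k l. k \<in> K \<Longrightarrow> l \<in> K \<Longrightarrow> k \<noteq> l \<Longrightarrow> B k \<inter> B l = {}"
  shows "\<mu> (\<Union>k\<in>K. B k) = (\<Sum>k\<in>K. \<mu> (B k))"
  using assms(2-)
proof (induction K)
  case empty
  show ?case using mean_Un_disjoint[OF mean, of "{}" "{}"] by simp
next
  case (insert k K)
  have "\<mu> (B k \<union> (\<Union>k\<in>K. B k)) = \<mu> (B k) + \<mu> (\<Union>k\<in>K. B k)"
  proof -
    have "B k \<inter> (\<Union>k\<in>K. B k) = {}" using insert.hyps insert.prems(2)[of k] by fastforce
    moreover have "B k \<subseteq> carrier G" "(\<Union>k\<in>K. B k) \<subseteq> carrier G" using insert.prems(1) by auto
    ultimately show ?thesis by (intro mean_Un_disjoint[OF mean])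
  qed
  with insert show ?case by simp
qed

section \<open>Piecewise translations, doubling and Folner sets in a group\<close>

context group
begin

text \<open>On each of the finitely many pieces \<open>P k\<close> the map \<open>f\<close> is left
  translation by \<open>k\<close>, which preserves the mean. Injectivity keeps the images disjoint,
  so the values add up to 1 again.\<close>

lemma mean_piecewise_translation:
  assumes inv: "left_invariant_mean G \<mu>" and K: "finite K" "K \<subseteq> carrier G"
    and inj: "inj_on f (carrier G)" and f: "\<And>x. x \<in> carrier G \<Longrightarrow> f x \<in> K #> x"
  shows "\<mu> (f ` carrier G) = 1"
proof -
  have mean: "is_mean G \<mu>" using inv by (simp add: left_invariant_mean_def)
  have "\<exists>k\<in>K. f x = k \<otimes> x" if "x \<in> carrier G" for x
    using f[OF that] by (auto simp: r_coset_def)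
  then obtain \<kappa> where \<kappa>: "\<And>x. x \<in> carrier G \<Longrightarrow> \<kappa> x \<in> K \<and> f x = \<kappa> x \<otimes> x" by metis
  define P where "P k = {x \<in> carrier G. \<kappa> x = k}" for k
  have fP: "f ` P k = k <# P k" if "k \<in> K" for k
    using \<kappa> by (force simp: P_def l_coset_def)
  have "f ` carrier G = (\<Union>k\<in>K. f ` P k)" using \<kappa> by (auto simp: P_def)
  moreover have "\<mu> (\<Union>k\<in>K. f ` P k) = (\<Sum>k\<in>K. \<mu> (f ` P k))"
  proof (rule mean_finite_Union[OF mean K(1)])
    show "f ` P k \<subseteq> carrier G" for k
      using \<kappa> K by (fastforce simp: P_def)
    show "f ` P k \<inter> f ` P l = {}" if "k \<noteq> l" for k l
      using inj that by (auto simp: P_def inj_on_def)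
  qed
  moreover have "\<mu> (f ` P k) = \<mu> (P k)" if "k \<in> K" for k
  proof -
    have "P k \<subseteq> carrier G" by (auto simp: P_def)
    then show ?thesis
      using inv that K unfolding fP[OF that] left_invariant_mean_def by blast
  qed
  moreover have "\<mu> (\<Union>k\<in>K. P k) = (\<Sum>k\<in>K. \<mu> (P k))"
    by (rule mean_finite_Union[OF mean K(1)]) (auto simp: P_def)
  moreover have "(\<Union>k\<in>K. P k) = carrier G" using \<kappa> by (auto simp: P_def)
  ultimately show ?thesis using mean by (simp add: is_mean_def)
qed

lemma amenable_not_doubling:
  assumes "amenable G" and K: "finite K" "K \<subseteq> carrier G"
  obtains F where "finite F" "F \<subseteq> carrier G" "card (K <#> F) < 2 * card F"
proof (rule ccontr)
  assume "\<not> thesis"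
  with that have doubling: "\<And>F. finite F \<Longrightarrow> F \<subseteq> carrier G \<Longrightarrow> 2 * card F \<le> card (K <#> F)"
    by (metis not_le)
  obtain \<mu> where inv: "left_invariant_mean G \<mu>" using assms(1) by (auto simp: amenable_def)
  then have mean: "is_mean G \<mu>" by (simp add: left_invariant_mean_def)
  have fin: "finite (K #> fst p)" if "p \<in> carrier G \<times> (UNIV :: bool set)" for p
    using K by (simp add: r_coset_def)
  \<comment> \<open>Each element is entered twice, tagged by a boolean. A finite set of tagged
    elements is at most twice as large as its projection, so doubling yields Hall's
    condition.\<close>
  have "hall (carrier G \<times> (UNIV :: bool set)) (\<lambda>p. K #> fst p)"
    unfolding hall_def
  proof (intro allI impI)
    fix J :: "('a \<times> bool) set" assume J: "J \<subseteq> carrier G \<times> UNIV" "finite J"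
    have "card J \<le> card (fst ` J \<times> (UNIV :: bool set))"
      using J by (intro card_mono) force+
    also have "\<dots> = 2 * card (fst ` J)" by (simp add: card_cartesian_product)
    also have "\<dots> \<le> card (K <#> fst ` J)" using J by (intro doubling) auto
    also have "K <#> fst ` J = (\<Union>p\<in>J. K #> fst p)" by (auto simp: set_mult_def r_coset_def)
    finally show "card J \<le> card (\<Union>p\<in>J. K #> fst p)" .
  qed
  from hall_marriage[OF fin this] obtain f where f: "inj_on f (carrier G \<times> (UNIV :: bool set))"
    "\<And>p. p \<in> carrier G \<times> UNIV \<Longrightarrow> f p \<in> K #> fst p"
    by metis
  let ?A = "\<lambda>i. (\<lambda>x. f (x, i)) ` carrier G"
  have one: "\<mu> (?A i) = 1" for i
  proof (rule mean_piecewise_translation[OF inv K])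
    show "inj_on (\<lambda>x. f (x, i)) (carrier G)"
      using inj_onD[OF f(1)] by (fastforce intro: inj_onI)
    show "f (x, i) \<in> K #> x" if "x \<in> carrier G" for x
      using f(2)[of "(x, i)"] that by simp
  qed
  have sub: "?A i \<subseteq> carrier G" for i
    using f(2) r_coset_subset_G[OF K(2)] by fastforce
  have "?A False \<inter> ?A True = {}" using f(1) by (auto simp: inj_on_def)
  then have "\<mu> (?A False \<union> ?A True) = 2"
    using mean_Un_disjoint[OF mean sub sub] one by simp
  moreover have "\<mu> (?A False \<union> ?A True) \<le> 1"
    by (intro mean_le_1[OF mean] Un_least sub)
  ultimately show False by simp
qed

text \<open>One-sided, but for finite \<open>F\<close> in the group \<open>k <# F\<close> has the
  size of \<open>F\<close>, so the symmetric difference is exactly twice as large as this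
  part.\<close>

definition almost_invariant :: "'a set \<Rightarrow> real \<Rightarrow> 'a set \<Rightarrow> bool" where
  "almost_invariant K \<epsilon> F \<longleftrightarrow> (\<forall>k\<in>K. real (card ((k <# F) - F)) \<le> \<epsilon> * real (card F))"

text \<open>If every \<open>F\<close> fails, a fixed finite set enlarges all finite sets by the
  factor \<open>1 + \<epsilon>\<close>. A high enough power of it enlarges them by more than 2,
  against \<open>amenable_not_doubling\<close>.\<close>

lemma amenable_folner:
  assumes "amenable G" and K: "finite K" "K \<subseteq> carrier G" and "\<epsilon> > 0"
  obtains F where "finite F" "F \<subseteq> carrier G" "F \<noteq> {}" "almost_invariant K \<epsilon> F"
proof (rule ccontr)
  assume "\<not> thesis"
  with that have not_inv: "\<And>F. finite F \<Longrightarrow> F \<subseteq> carrier G \<Longrightarrow> F \<noteq> {} \<Longrightarrow> \<not> almost_invariant K \<epsilon> F"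
    by blast
  \<comment> \<open>The unit keeps \<open>F\<close> inside the product, so that
    \<open>(k <# F) - F\<close> is a genuine gain.\<close>
  let ?S = "insert \<one> K"
  have fin: "finite (A <#> B)" if "finite A" "finite B" for A B
    using that by (auto simp: set_mult_def)
  have expand: "(1 + \<epsilon>) * card F \<le> card (?S <#> F)" if F: "finite F" "F \<subseteq> carrier G" for F
  proof (cases "F = {}")
    case False
    then obtain k where k: "k \<in> K" "\<epsilon> * card F < card ((k <# F) - F)"
      using not_inv F unfolding almost_invariant_def by (auto simp: not_le)
    have "finite (k <# F)" using F by (simp add: l_coset_def)
    then have "card (F \<union> ((k <# F) - F)) = card F + card ((k <# F) - F)"
      using F by (intro card_Un_disjoint) auto
    moreover have "F \<union> ((k <# F) - F) \<subseteq> ?S <#> F"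
      using F k by (force simp: l_coset_def set_mult_def)
    then have "card (F \<union> ((k <# F) - F)) \<le> card (?S <#> F)"
      using F K by (intro card_mono fin) auto
    moreover have "(1 + \<epsilon>) * card F = card F + \<epsilon> * card F" by (simp add: distrib_right)
    ultimately show ?thesis using k(2) by linarith
  qed auto
  have powers: "\<exists>L. finite L \<and> L \<subseteq> carrier G \<and>
      (\<forall>F. finite F \<longrightarrow> F \<subseteq> carrier G \<longrightarrow> (1 + \<epsilon>) ^ n * card F \<le> card (L <#> F))" for n
  proof (induction n)
    case 0
    have "{\<one>} <#> F = F" if "F \<subseteq> carrier G" for F
      using that by (force simp: set_mult_def)
    then show ?case by (intro exI[of _ "{\<one>}"]) auto
  next
    case (Suc n)
    then obtain L where L: "finite L" "L \<subseteq> carrier G"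
      "\<And>F. finite F \<Longrightarrow> F \<subseteq> carrier G \<Longrightarrow> (1 + \<epsilon>) ^ n * card F \<le> card (L <#> F)"
      by blast
    have S: "?S \<subseteq> carrier G" using K by auto
    have "(1 + \<epsilon>) ^ Suc n * card F \<le> card ((?S <#> L) <#> F)"
      if F: "finite F" "F \<subseteq> carrier G" for F
    proof -
      have "(1 + \<epsilon>) ^ Suc n * card F \<le> (1 + \<epsilon>) * card (L <#> F)"
        using L(3)[OF F] \<open>\<epsilon> > 0\<close> by (simp add: mult.assoc)
      also have "\<dots> \<le> card (?S <#> (L <#> F))"
        using L F by (intro expand fin set_mult_closed)
      finally show ?thesis using set_mult_assoc[OF S L(2) F(2)] by simp
    qed
    moreover have "finite (?S <#> L)" using L K by (intro fin) auto
    moreover have "?S <#> L \<subseteq> carrier G" using S L by (intro set_mult_closed)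
    ultimately show ?case by blast
  qed
  obtain n where n: "2 < (1 + \<epsilon>) ^ n"
    using real_arch_pow[of "1 + \<epsilon>" 2] \<open>\<epsilon> > 0\<close> by auto
  obtain L where L: "finite L" "L \<subseteq> carrier G"
      "\<And>F. finite F \<Longrightarrow> F \<subseteq> carrier G \<Longrightarrow> (1 + \<epsilon>) ^ n * card F \<le> card (L <#> F)"
    using powers[of n] by blast
  obtain F where F: "finite F" "F \<subseteq> carrier G" "card (L <#> F) < 2 * card F"
    using amenable_not_doubling[OF assms(1) L(1,2)] .
  have "2 * real (card F) \<le> (1 + \<epsilon>) ^ n * card F"
    using n by (intro mult_right_mono) auto
  with L(3)[OF F(1,2)] F(3) show False by linarith
qed

text \<open>Right translation is injective and commutes with left translations, so it carries
  \<open>(k <# F) - F\<close> to the corresponding difference for the translate.\<close>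

lemma almost_invariant_r_coset:
  assumes "almost_invariant K \<epsilon> F" "K \<subseteq> carrier G" "F \<subseteq> carrier G" "g \<in> carrier G"
  shows "almost_invariant K \<epsilon> (F #> g)"
proof -
  have eq: "A #> g = (\<lambda>x. x \<otimes> g) ` A" for A by (auto simp: r_coset_def)
  have inj: "inj_on (\<lambda>x. x \<otimes> g) (carrier G)" using assms(4) by (intro inj_onI) auto
  have card: "card (A #> g) = card A" if "A \<subseteq> carrier G" for A
    unfolding eq using inj that by (meson card_image inj_on_subset)
  have "card ((k <# (F #> g)) - (F #> g)) = card ((k <# F) - F)" if "k \<in> K" for k
  proof -
    have k: "k \<in> carrier G" using that assms by auto
    have sub: "k <# F \<subseteq> carrier G" using k assms by (simp add: l_coset_subset_G)
    have "k <# (F #> g) = (k <# F) #> g"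
      using k assms by (simp add: rcos_assoc_lcos coset_assoc)
    then have "(k <# (F #> g)) - (F #> g) = ((k <# F) - F) #> g"
      unfolding eq using inj sub assms(3) by (simp add: inj_on_image_set_diff[of _ "carrier G"] Diff_subset_conv le_supI2)
    moreover have "card (((k <# F) - F) #> g) = card ((k <# F) - F)"
      using sub by (intro card) auto
    ultimately show ?thesis by simp
  qed
  then show ?thesis using assms(1) card[OF assms(3)] by (simp add: almost_invariant_def)
qed

text \<open>All the sets are right translates of a single one. Their common size \<open>n\<close> is
  fixed before \<open>B\<close>, so \<open>B\<close> may be chosen in terms of
  \<open>n\<close>.\<close>

lemma amenable_folner_avoiding:
  assumes "amenable G" "infinite (carrier G)" and K: "finite K" "K \<subseteq> carrier G" and "\<epsilon> > 0"
  obtains n where "n > 0"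
    "\<And>B. finite B \<Longrightarrow> \<exists>F. finite F \<and> F \<subseteq> carrier G \<and> card F = n \<and> almost_invariant K \<epsilon> F \<and> F \<inter> B = {}"
proof -
  obtain F where F: "finite F" "F \<subseteq> carrier G" "F \<noteq> {}" "almost_invariant K \<epsilon> F"
    using amenable_folner[OF assms(1) K \<open>\<epsilon> > 0\<close>] .
  show ?thesis
  proof
    show "card F > 0" using F by (simp add: card_gt_0_iff)
  next
    fix B :: "'a set" assume "finite B"
    \<comment> \<open>Contains every group element \<open>g\<close> for which \<open>F #> g\<close>
      meets \<open>B\<close>.\<close>
    let ?X = "(\<lambda>(x, b). inv x \<otimes> b) ` (F \<times> B)"
    have "finite ?X" using F \<open>finite B\<close> by auto
    then obtain g where g: "g \<in> carrier G" "g \<notin> ?X"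
      using assms(2) by (meson finite_subset subsetI)
    have "F #> g = (\<lambda>x. x \<otimes> g) ` F" by (auto simp: r_coset_def)
    moreover have "inj_on (\<lambda>x. x \<otimes> g) (carrier G)" using g(1) by (intro inj_onI) auto
    then have "inj_on (\<lambda>x. x \<otimes> g) F" using F(2) by (rule inj_on_subset)
    ultimately have "card (F #> g) = card F" "finite (F #> g)" using F by (auto simp: card_image)
    moreover have "(F #> g) \<inter> B = {}"
    proof (rule ccontr)
      assume "(F #> g) \<inter> B \<noteq> {}"
      then obtain x where x: "x \<in> F" "x \<otimes> g \<in> B" by (auto simp: r_coset_def)
      then have "x \<in> carrier G" using F(2) by blast
      then have "inv x \<otimes> (x \<otimes> g) = g" using g(1) by (simp flip: m_assoc)
      then have "g \<in> ?X" using x by (intro image_eqI[of _ _ "(x, x \<otimes> g)"]) auto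
      with g(2) show False by contradiction
    qed
    moreover have "almost_invariant K \<epsilon> (F #> g)"
      using F(4) K(2) F(2) g(1) by (rule almost_invariant_r_coset)
    moreover have "F #> g \<subseteq> carrier G" using F(2) g(1) by (rule r_coset_subset_G)
    ultimately show "\<exists>F'. finite F' \<and> F' \<subseteq> carrier G \<and> card F' = card F \<and>
        almost_invariant K \<epsilon> F' \<and> F' \<inter> B = {}" by blast
  qed
qed

text \<open>Normalisation and additivity pass to the limit. For invariance, multiplication by
  \<open>inv h\<close> sends \<open>(h <# A) \<inter> F n\<close> into \<open>A \<inter> F n\<close>
  up to points of \<open>(inv h <# F n) - F n\<close>, whose proportion is eventually at most any
  given \<open>\<epsilon>\<close>.\<close>

lemma limit_of_folner_means:
  assumes F: "\<And>n. finite (F n)" "\<And>n. F n \<subseteq> carrier G" "\<And>n. F n \<noteq> {}"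
    and inv: "\<And>h \<epsilon>. h \<in> carrier G \<Longrightarrow> \<epsilon> > 0 \<Longrightarrow> \<forall>\<^sub>F n in sequentially. almost_invariant {h} \<epsilon> (F n)"
    and \<G>: "\<G> \<le> sequentially" "\<G> \<noteq> bot"
    and lim: "\<And>A. ((\<lambda>n. card (A \<inter> F n) / card (F n)) \<longlongrightarrow> \<mu> A) \<G>"
  shows "left_invariant_mean G \<mu>"
proof -
  have pos: "card (F n) > 0" for n using F by (simp add: card_gt_0_iff)
  have "0 \<le> \<mu> A" for A
    using \<G>(2) lim by (rule tendsto_lowerbound[rotated 2]) auto
  moreover have "\<mu> A \<le> 1" for A
  proof (rule tendsto_upperbound[OF lim _ \<G>(2)])
    show "\<forall>\<^sub>F n in \<G>. card (A \<inter> F n) / card (F n) \<le> 1"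
      using pos F(1) by (intro always_eventually allI) (simp add: card_mono)
  qed
  moreover have "\<mu> (carrier G) = 1"
  proof -
    have "carrier G \<inter> F n = F n" for n using F(2) by blast
    then have "card (carrier G \<inter> F n) / card (F n) = 1" for n using pos[of n] by simp
    then have "((\<lambda>_. 1) \<longlongrightarrow> \<mu> (carrier G)) \<G>" using lim[of "carrier G"] by (simp only:)
    then show ?thesis using \<G>(2) by (simp add: tendsto_const_iff)
  qed
  moreover have "\<mu> (A \<union> B) = \<mu> A + \<mu> B" if "A \<inter> B = {}" for A B
  proof (rule tendsto_unique[OF \<G>(2) lim])
    have "card ((A \<union> B) \<inter> F n) = card (A \<inter> F n) + card (B \<inter> F n)" for n
      using that F(1)[of n] by (subst card_Un_disjoint[symmetric]) (auto simp: Int_Un_distrib2)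
    then show "((\<lambda>n. card ((A \<union> B) \<inter> F n) / card (F n)) \<longlongrightarrow> \<mu> A + \<mu> B) \<G>"
      using tendsto_add[OF lim[of A] lim[of B]] by (simp add: add_divide_distrib)
  qed
  ultimately have mean: "is_mean G \<mu>" unfolding is_mean_def by blast
  have le: "\<mu> (h <# A) \<le> \<mu> A" if h: "h \<in> carrier G" and A: "A \<subseteq> carrier G" for h A
  proof (rule field_le_epsilon)
    fix \<epsilon> :: real assume "\<epsilon> > 0"
    have "card ((h <# A) \<inter> F n) / card (F n) \<le> card (A \<inter> F n) / card (F n) + \<epsilon>"
      if ai: "almost_invariant {inv h} \<epsilon> (F n)" for n
    proof -
      have fin: "finite (inv h <# F n)" using F(1) by (simp add: l_coset_def)
      have "card ((h <# A) \<inter> F n) \<le> card ((A \<inter> F n) \<union> ((inv h <# F n) - F n))"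
      proof (rule card_inj_on_le)
        show "inj_on (\<lambda>x. inv h \<otimes> x) ((h <# A) \<inter> F n)"
          by (rule inj_on_subset[of _ "carrier G"]) (use h F(2) in \<open>auto intro!: inj_onI\<close>)
        show "(\<lambda>x. inv h \<otimes> x) ` ((h <# A) \<inter> F n) \<subseteq> (A \<inter> F n) \<union> ((inv h <# F n) - F n)"
        proof (intro image_subsetI)
          fix x assume x: "x \<in> (h <# A) \<inter> F n"
          then obtain a where a: "a \<in> A" "x = h \<otimes> a" by (auto simp: l_coset_def)
          then have "a \<in> carrier G" using A by blast
          then have "inv h \<otimes> x = a" using a h by (simp flip: m_assoc)
          moreover have "inv h \<otimes> x \<in> inv h <# F n" using x by (auto simp: l_coset_def)
          ultimately show "inv h \<otimes> x \<in> (A \<inter> F n) \<union> ((inv h <# F n) - F n)"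
            using a(1) by auto
        qed
        show "finite ((A \<inter> F n) \<union> ((inv h <# F n) - F n))" using F(1) fin by simp
      qed
      also have "\<dots> \<le> card (A \<inter> F n) + card ((inv h <# F n) - F n)" by (rule card_Un_le)
      finally have "real (card ((h <# A) \<inter> F n)) \<le> card (A \<inter> F n) + \<epsilon> * card (F n)"
        using ai unfolding almost_invariant_def by simp
      then show ?thesis using pos[of n] by (simp add: field_simps)
    qed
    moreover have "\<forall>\<^sub>F n in \<G>. almost_invariant {inv h} \<epsilon> (F n)"
      using inv[of "inv h" \<epsilon>] h \<open>\<epsilon> > 0\<close> \<G>(1) by (auto intro: filter_leD)
    ultimately have "\<forall>\<^sub>F n in \<G>. card ((h <# A) \<inter> F n) / card (F n) \<le> card (A \<inter> F n) / card (F n) + \<epsilon>"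
      by (auto elim: eventually_mono)
    then show "\<mu> (h <# A) \<le> \<mu> A + \<epsilon>"
      by (rule tendsto_le[OF \<G>(2) tendsto_add[OF lim tendsto_const] lim])
  qed
  \<comment> \<open>The reverse inequality is \<open>le\<close> for \<open>inv h\<close> and the set
    \<open>h <# A\<close>.\<close>
  have "\<mu> (h <# A) = \<mu> A" if h: "h \<in> carrier G" and A: "A \<subseteq> carrier G" for h A
  proof (rule antisym[OF le[OF h A]])
    have "inv h <# (h <# A) = A" using h A by (simp add: lcos_m_assoc lcos_mult_one)
    then show "\<mu> A \<le> \<mu> (h <# A)"
      using le[of "inv h" "h <# A"] h A by (simp add: l_coset_subset_G)
  qed
  with mean show ?thesis by (simp add: left_invariant_mean_def)
qed

text \<open>A greedy choice: each stage has only finitely many points to avoid. Countability lets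
  the invariance condition at stage \<open>n\<close> cover the first \<open>n + 1\<close> terms of
  an enumeration, so each element is covered from some stage on.\<close>

lemma amenable_folner_sequence:
  fixes bad :: "nat \<Rightarrow> 'a set" and shadow :: "'a set \<Rightarrow> 'a set"
  assumes "amenable G" "infinite (carrier G)" "countable (carrier G)"
    and bad: "\<And>N. finite (bad N)" and shadow: "\<And>Y. finite Y \<Longrightarrow> finite (shadow Y)"
  obtains F where "\<And>n. finite (F n)" "\<And>n. F n \<subseteq> carrier G" "\<And>n. F n \<noteq> {}"
    "\<And>h \<epsilon>. h \<in> carrier G \<Longrightarrow> \<epsilon> > 0 \<Longrightarrow> \<forall>\<^sub>F n in sequentially. almost_invariant {h} \<epsilon> (F n)"
    "\<And>n. F n \<inter> bad (card (F n)) = {}"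
    "\<And>m n. m < n \<Longrightarrow> F n \<inter> shadow (F m) = {}"
proof -
  let ?e = "from_nat_into (carrier G)"
  define good where "good n F \<longleftrightarrow> finite F \<and> F \<subseteq> carrier G \<and> F \<noteq> {} \<and>
    almost_invariant (?e ` {..n}) (1 / Suc n) F \<and> F \<inter> bad (card F) = {}" for n F
  have ex_good: "\<exists>F. good n F \<and> F \<inter> B = {}" if "finite B" for n B
  proof -
    have "?e ` {..n} \<subseteq> carrier G" by (auto intro: from_nat_into)
    then obtain N where N: "N > 0"
      "\<And>B. finite B \<Longrightarrow> \<exists>F. finite F \<and> F \<subseteq> carrier G \<and> card F = N \<and>
         almost_invariant (?e ` {..n}) (1 / Suc n) F \<and> F \<inter> B = {}"
      using amenable_folner_avoiding[OF assms(1,2), of "?e ` {..n}" "1 / Suc n"] by auto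
    \<comment> \<open>The size \<open>N\<close> is known before the set is chosen, so
      \<open>bad N\<close> can be avoided along with \<open>B\<close>.\<close>
    have "finite (B \<union> bad N)" using that bad by simp
    from N(2)[OF this] obtain F where F: "finite F" "F \<subseteq> carrier G" "card F = N"
      "almost_invariant (?e ` {..n}) (1 / Suc n) F" "F \<inter> (B \<union> bad N) = {}"
      by blast
    then have "good n F" "F \<inter> B = {}" using N(1) unfolding good_def by auto
    then show ?thesis by blast
  qed
  \<comment> \<open>The second component accumulates the shadows of all earlier sets, so that
    avoiding every one of them becomes a condition on the current state alone.\<close>
  have "\<exists>s. \<forall>n. (good n (fst (s n)) \<and> finite (snd (s n)) \<and> fst (s n) \<inter> snd (s n) = {}) \<and>
    snd (s (Suc n)) = snd (s n) \<union> shadow (fst (s n))"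
  proof (rule dependent_nat_choice)
    show "\<exists>s. good 0 (fst s) \<and> finite (snd s) \<and> fst s \<inter> snd s = {}"
      using ex_good[of "{}" 0] by auto
  next
    fix s :: "'a set \<times> 'a set" and n
    assume s: "good n (fst s) \<and> finite (snd s) \<and> fst s \<inter> snd s = {}"
    then have fin: "finite (snd s \<union> shadow (fst s))" using shadow by (simp add: good_def)
    from ex_good[OF this] obtain F where "good (Suc n) F" "F \<inter> (snd s \<union> shadow (fst s)) = {}" by blast
    with fin show "\<exists>t. (good (Suc n) (fst t) \<and> finite (snd t) \<and> fst t \<inter> snd t = {}) \<and>
        snd t = snd s \<union> shadow (fst s)"
      by (intro exI[of _ "(F, snd s \<union> shadow (fst s))"]) simp
  qed
  then obtain s where s: "\<And>n. good n (fst (s n))" "\<And>n. fst (s n) \<inter> snd (s n) = {}"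
    "\<And>n. snd (s (Suc n)) = snd (s n) \<union> shadow (fst (s n))"
    by blast
  have past: "shadow (fst (s m)) \<subseteq> snd (s n)" if "m < n" for m n
    using that by (induction n) (auto simp: s(3) less_Suc_eq)
  show ?thesis
  proof
    show "finite (fst (s n))" "fst (s n) \<subseteq> carrier G" "fst (s n) \<noteq> {}"
      "fst (s n) \<inter> bad (card (fst (s n))) = {}" for n
      using s(1)[of n] by (simp_all add: good_def)
    show "fst (s n) \<inter> shadow (fst (s m)) = {}" if "m < n" for m n
      using past[OF that] s(2)[of n] by blast
  next
    fix h and \<epsilon> :: real assume h: "h \<in> carrier G" and "\<epsilon> > 0"
    obtain k where k: "?e k = h" using from_nat_into_surj[OF assms(3) h] by blast
    obtain N where N: "1 / Suc N < \<epsilon>" using \<open>\<epsilon> > 0\<close> by (rule nat_approx_posE)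
    have "almost_invariant {h} \<epsilon> (fst (s n))" if n: "n \<ge> max k N" for n
    proof -
      have "1 / Suc n \<le> 1 / Suc N" using n by (simp add: field_simps)
      then have "1 / Suc n \<le> \<epsilon>" using N by linarith
      then have le: "1 / Suc n * card (fst (s n)) \<le> \<epsilon> * card (fst (s n))"
        by (rule mult_right_mono) simp
      have "h \<in> ?e ` {..n}" using n k by auto
      with s(1)[of n] have "card ((h <# fst (s n)) - fst (s n)) \<le> 1 / Suc n * card (fst (s n))"
        unfolding good_def almost_invariant_def by blast
      from order_trans[OF this le] show ?thesis by (simp add: almost_invariant_def)
    qed
    then show "\<forall>\<^sub>F n in sequentially. almost_invariant {h} \<epsilon> (fst (s n))"
      by (rule eventually_sequentiallyI)
  qed
qed

end

text \<open>A single orbit is an image of the countable set of words. This supplies the enumeration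
  behind the Folner sequence.\<close>

lemma f2_action_transitive_countable:
  assumes "f2_action_transitive U sa sb"
  shows "countable U"
proof (cases "U = {}")
  case False
  then obtain x where "x \<in> U" by blast
  then have "U \<subseteq> range (\<lambda>w. word_act U sa sb w x)"
    using assms unfolding f2_action_transitive_def by (metis rangeI subsetI)
  then show ?thesis by (rule countable_subset) simp
qed simp

section \<open>The contradiction between invariance and the forest bound\<close>

theorem theorem6p1:
  fixes H :: "('a, 'b) monoid_scheme"
  assumes "group H"
    and "infinite (carrier H)"
    and "finitely_generated H"
    and "amenable H"
  shows "\<not> (\<exists>sa sb.
            bij_betw sa (carrier H) (carrier H) \<and>
            bij_betw sb (carrier H) (carrier H) \<and>
            f2_action_transitive (carrier H) sa sb \<and>
            f2_action_almost_free (carrier H) sa sb \<and>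
            (\<forall>\<mu>. left_invariant_mean H \<mu> \<longrightarrow> f2_invariant (carrier H) sa sb \<mu>))"
proof
  interpret group H by fact
  let ?U = "carrier H"
  assume "\<exists>sa sb. bij_betw sa ?U ?U \<and> bij_betw sb ?U ?U \<and> f2_action_transitive ?U sa sb \<and>
    f2_action_almost_free ?U sa sb \<and> (\<forall>\<mu>. left_invariant_mean H \<mu> \<longrightarrow> f2_invariant ?U sa sb \<mu>)"
  then obtain sa sb where bij: "bij_betw sa ?U ?U" "bij_betw sb ?U ?U"
    and trans: "f2_action_transitive ?U sa sb" and free: "f2_action_almost_free ?U sa sb"
    and inv: "\<And>\<mu>. left_invariant_mean H \<mu> \<Longrightarrow> f2_invariant ?U sa sb \<mu>"
    by blast
  \<comment> \<open>There are finitely many words of length at most \<open>N\<close>, each with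
    finitely many fixed points by almost freeness. Avoiding \<open>bad (card F)\<close> is what
    \<open>card_image_Int_less\<close> demands of \<open>F\<close>.\<close>
  define bad where "bad N = (\<Union>w\<in>{w. reduced_word w \<and> w \<noteq> [] \<and> length w \<le> N}.
    {x \<in> ?U. word_act ?U sa sb w x = x})" for N
  have "finite (bad N)" for N
    unfolding bad_def
  proof (intro finite_UN_I)
    show "finite {w. reduced_word w \<and> w \<noteq> [] \<and> length w \<le> N}"
      by (rule finite_subset[OF _ finite_lists_length_le[of UNIV N]]) auto
    show "finite {x \<in> ?U. word_act ?U sa sb w x = x}"
      if "w \<in> {w. reduced_word w \<and> w \<noteq> [] \<and> length w \<le> N}" for w
      using free that unfolding f2_action_almost_free_def by blast
  qed
  \<comment> \<open>Preimages are included so that avoiding the earlier sets excludes edges in both directions.\<close>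
  moreover define shadow where "shadow Y = sa ` Y \<union> sb ` Y \<union> inv_into ?U sa ` Y \<union> inv_into ?U sb ` Y" for Y
  then have "finite (shadow Y)" if "finite Y" for Y using that by simp
  ultimately obtain F where F: "\<And>n. finite (F n)" "\<And>n. F n \<subseteq> ?U" "\<And>n. F n \<noteq> {}"
    and folner: "\<And>h \<epsilon>. h \<in> ?U \<Longrightarrow> \<epsilon> > 0 \<Longrightarrow> \<forall>\<^sub>F n in sequentially. almost_invariant {h} \<epsilon> (F n)"
    and not_bad: "\<And>n. F n \<inter> bad (card (F n)) = {}"
    and disj: "\<And>m n. m < n \<Longrightarrow> F n \<inter> shadow (F m) = {}"
    using amenable_folner_sequence[OF assms(4,2) f2_action_transitive_countable[OF trans], of bad shadow]
    by blast
  have pos: "card (F n) > 0" for n using F by (simp add: card_gt_0_iff)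
  have "card (A \<inter> F n) / card (F n) \<in> {0..1}" for n A
    using pos[of n] F(1)[of n] by (simp add: card_mono)
  then obtain \<G> \<mu> where \<G>: "\<G> \<le> sequentially" "\<G> \<noteq> bot"
    and lim: "\<And>A. ((\<lambda>n. card (A \<inter> F n) / card (F n)) \<longlongrightarrow> \<mu> A) \<G>"
    using bounded_family_limit_filter[of "\<lambda>n A. card (A \<inter> F n) / card (F n)"] by metis
  have mean: "left_invariant_mean H \<mu>"
    using limit_of_folner_means[OF F folner \<G> lim] .
  define A where "A = (\<Union>n. F n)"
  have A: "A \<subseteq> ?U" using F(2) by (auto simp: A_def)
  \<comment> \<open>The proportion of \<open>A\<close> in \<open>F n\<close> is 1 for every
    \<open>n\<close>, so any limit gives \<open>A\<close> mean 1.\<close>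
  have "A \<inter> F n = F n" for n by (auto simp: A_def)
  then have "card (A \<inter> F n) / card (F n) = 1" for n using pos[of n] by simp
  then have "((\<lambda>_. 1) \<longlongrightarrow> \<mu> A) \<G>" using lim[of A] by (simp only:)
  then have "\<mu> A = 1" using \<G>(2) by (simp add: tendsto_const_iff)
  \<comment> \<open>A one-letter word is vacuously reduced, so invariance applies to each
    letter.\<close>
  have generator: "\<mu> (letter_act ?U sa sb c ` A) = 1" for c
  proof -
    have "word_act ?U sa sb [c] = letter_act ?U sa sb c" by auto
    then show ?thesis
      using inv[OF mean] A \<open>\<mu> A = 1\<close> unfolding f2_invariant_def
      by (metis One_nat_def Suc_less_eq length_Cons list.size(3) not_less0 reduced_word_def)
  qed
  have "\<mu> (sa ` A) = 1" "\<mu> (sb ` A) = 1"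
    using generator[of "(False, False)"] generator[of "(True, False)"] by (simp_all add: letter_act_def)
  \<comment> \<open>Invariance forces the two proportions to sum to 2 in the limit, while the forest
    bound keeps the sum below 1 at every \<open>n\<close>.\<close>
  then have "((\<lambda>n. card (sa ` A \<inter> F n) / card (F n) + card (sb ` A \<inter> F n) / card (F n)) \<longlongrightarrow> 2) \<G>"
    using tendsto_add[OF lim[of "sa ` A"] lim[of "sb ` A"]] by simp
  moreover have "card (sa ` A \<inter> F n) / card (F n) + card (sb ` A \<inter> F n) / card (F n) \<le> 1" for n
  proof -
    \<comment> \<open>No generator joins distinct sets of the sequence, so the image of
      \<open>A\<close> meets \<open>F n\<close> only in images of points of \<open>F n\<close>. The
      count thus concerns one finite graph.\<close>
    have local: "t ` A \<inter> F n = t ` F n \<inter> F n"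
      if t: "bij_betw t ?U ?U" "\<And>Y. t ` Y \<union> inv_into ?U t ` Y \<subseteq> shadow Y" for t
    proof -
      have "m = n" if y: "y \<in> F m" "t y \<in> F n" for m y
      proof (rule linorder_cases[of m n])
        assume "m < n"
        then show ?thesis using disj[of m n] t(2)[of "F m"] y by blast
      next
        assume "n < m"
        have "inv_into ?U t (t y) = y" using t(1) y(1) F(2) by (meson bij_betw_inv_into_left subsetD)
        then have "y \<in> shadow (F n)" using t(2)[of "F n"] y(2) by (metis Un_subset_iff image_subset_iff)
        then show ?thesis using disj[OF \<open>n < m\<close>] y(1) by blast
      qed
      then show ?thesis by (auto simp: A_def)
    qed
    have "word_act ?U sa sb w x \<noteq> x"
      if "reduced_word w" "w \<noteq> []" "length w \<le> card (F n)" "x \<in> F n" for w x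
      using not_bad[of n] F(2)[of n] that unfolding bad_def by blast
    then have "card (sa ` F n \<inter> F n) + card (sb ` F n \<inter> F n) < card (F n)"
      by (rule card_image_Int_less[OF bij F(1,2,3)])
    moreover have "sa ` A \<inter> F n = sa ` F n \<inter> F n" "sb ` A \<inter> F n = sb ` F n \<inter> F n"
      using bij by (auto intro!: local simp: shadow_def)
    ultimately show ?thesis using pos[of n] by (simp add: field_simps flip: of_nat_add)
  qed
  ultimately have "2 \<le> (1::real)"
    by (intro tendsto_upperbound[OF _ _ \<G>(2)]) auto
  then show False by simp
qed

end
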